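(* Let $n\geq 2$, $\delta\geq 0$, $k\geq 0$ and $m$ be integers with $2m\geq n\delta$. Then $$\max_{t\geq 1}\left\lceil f_t(n,m,\delta,k)\right\rceil\ =\ s^{\ast}(n,m,\delta,k)\ =\ \min\{\mathrm{sp}(D,k):D\in\mathcal{D}\},$$ where $\mathcal{D}$ is the set of all $\delta$-sequences of length $n$ with sum $2m$, and the maximum is over integers $t\ge 1$.
   Context: Put $h=k+1$. A $\delta$-sequence of length $n$ is a nondecreasing sequence $D=(d_1\leq\cdots\leq d_n)$ of integers with $d_1=\delta$. Its window number $\mathrm{sp}(D,k)$ is the largest number of its terms (counted with multiplicity) lying in an interval of $k+1$ consecutive integers. For integers $t\geq 1$, $$f_t(n,m,\delta,k)=\frac{2\left(n(\delta+t(k+1))-2m\right)}{(k+1)\,t(t+1)}.$$ For $1\leq s\leq n$ put $$\Sigma(n,s)=n\delta+h\sum_{i=1}^{n}\left\lfloor\frac{i-1}{s}\right\rfloor ,$$ and for $2m\geq n\delta$ let $s^{\ast}(n,m,\delta,k)=\min\{s\geq 1:\Sigma(n,s)\leq 2m\}$, which is well defined because $\Sigma(n,n)=n\delta$. *)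

theory Defs
  imports Complex_Main
begin

definition delta_sequence :: "int \<Rightarrow> nat \<Rightarrow> int list \<Rightarrow> bool" where
  "delta_sequence \<delta> n D \<longleftrightarrow> length D = n \<and> D \<noteq> [] \<and> sorted D \<and> hd D = \<delta>"

definition delta_sequences_with_sum :: "nat \<Rightarrow> int \<Rightarrow> int \<Rightarrow> int list set" where
  "delta_sequences_with_sum n m \<delta> = {D. delta_sequence \<delta> n D \<and> sum_list D = 2 * m}"

definition window_count :: "int list \<Rightarrow> int \<Rightarrow> int \<Rightarrow> nat" where
  "window_count D k a = length (filter (\<lambda>d. d \<in> {a..a + k}) D)"

definition sp :: "int list \<Rightarrow> int \<Rightarrow> nat" where
  "sp D k = Max (range (window_count D k))"

text \<open>The maximum is taken over infinitely many windows, but only finitely many values occur.\<close>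

lemma finite_range_window_count: "finite (range (window_count D k))"
proof (rule finite_subset)
  show "range (window_count D k) \<subseteq> {..length D}"
    by (auto simp: window_count_def)
qed simp

definition f_val :: "nat \<Rightarrow> int \<Rightarrow> int \<Rightarrow> int \<Rightarrow> nat \<Rightarrow> real" where
  "f_val n m \<delta> k t =
     2 * (real n * (of_int \<delta> + real t * (of_int k + 1)) - 2 * of_int m)
       / ((of_int k + 1) * real t * (real t + 1))"

text \<open>On natural numbers, \<open>div\<close> is the floor of the quotient.\<close>

definition Sigma_sum :: "int \<Rightarrow> int \<Rightarrow> nat \<Rightarrow> nat \<Rightarrow> int" where
  "Sigma_sum \<delta> k n s = int n * \<delta> + (k + 1) * (\<Sum>i = 1..n. int ((i - 1) div s))"

definition s_star :: "nat \<Rightarrow> int \<Rightarrow> int \<Rightarrow> int \<Rightarrow> nat" where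
  "s_star n m \<delta> k = (LEAST s. 1 \<le> s \<and> Sigma_sum \<delta> k n s \<le> 2 * m)"

lemma Sigma_sum_self: "Sigma_sum \<delta> k n n = int n * \<delta>"
proof -
  have "(\<Sum>i = 1..n. int ((i - 1) div n)) = 0"
    by (rule sum.neutral) auto
  then show ?thesis
    by (simp add: Sigma_sum_def)
qed

lemma s_star_well_defined:
  assumes "1 \<le> n" and "int n * \<delta> \<le> 2 * m"
  shows "1 \<le> s_star n m \<delta> k \<and> Sigma_sum \<delta> k n (s_star n m \<delta> k) \<le> 2 * m"
  unfolding s_star_def
  by (rule LeastI[where k = n]) (use assms in \<open>simp add: Sigma_sum_self\<close>)

end

theory Submission
  imports Defs
begin

text \<open>
  Write \<open>h = k + 1\<close> and \<open>T n s\<close> for the sum of \<open>i div s\<close> over \<open>i < n\<close>. As a function of \<open>t\<close>,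
  the quantity \<open>n t - s t (t + 1) / 2\<close> is concave with maximum \<open>T n s\<close>, attained at
  \<open>t = n div s\<close> (the excluded case \<open>t = 0\<close> only asks for \<open>2 m \<ge> n \<delta>\<close>); hence \<open>s \<ge> 1\<close> bounds all
  \<open>f_t\<close> iff \<open>Sigma_sum \<delta> k n s \<le> 2 * m\<close>, which gives the first equality.
  A sorted sequence has window number at most \<open>s\<close> iff terms at distance \<open>s\<close> differ by at least \<open>h\<close>. This forces \<open>d\<^sub>i \<ge> \<delta> + h (i div s)\<close> (indices from 0), so the sum is at least
  \<open>Sigma_sum \<delta> k n s\<close>; conversely the extremal sequence can absorb any surplus in its last term.
\<close>

section \<open>Sums of the floor quotients \<open>i div s\<close>\<close>

lemma Sigma_sum_lessThan:
  "Sigma_sum \<delta> k n s = int n * \<delta> + (k + 1) * (\<Sum>i<n. int (i div s))"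
  by (simp add: Sigma_sum_def sum.atLeast1_atMost_eq)

text \<open>The indices below \<open>n\<close> split into \<open>n div s\<close> full blocks of
  length \<open>s\<close>, on which \<open>i div s\<close> takes the values 0, 1, 2, and so on,
  followed by \<open>n mod s\<close> terms equal to \<open>n div s\<close>.\<close>

lemma double_sum_div:
  assumes "0 < s"
  shows "2 * (\<Sum>i<n. int (i div s))
    = int s * int (n div s) * (int (n div s) - 1) + 2 * int (n mod s) * int (n div s)"
proof (induction n)
  case 0
  then show ?case by simp
next
  case (Suc n)
  define q r where "q = n div s" and "r = n mod s"
  have IH: "2 * (\<Sum>i<n. int (i div s)) = int s * int q * (int q - 1) + 2 * int r * int q"
    using Suc unfolding q_def r_def .
  show ?case
  proof (cases "Suc r = s")
    case True
    then have "Suc n mod s = 0" "Suc n div s = Suc q"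
      by (auto simp: mod_Suc div_Suc q_def r_def)
    moreover have "int s = int r + 1"
      using True by simp
    ultimately show ?thesis
      using IH by (simp add: q_def[symmetric] algebra_simps)
  next
    case False
    then have "Suc n mod s = Suc r" "Suc n div s = q"
      by (auto simp: mod_Suc div_Suc q_def r_def)
    then show ?thesis
      using IH by (simp add: q_def[symmetric] algebra_simps)
  qed
qed

text \<open>Centring at the maximiser \<open>n div s\<close> makes the deficit a quadratic in
  \<open>d\<close> that vanishes at \<open>d = 0\<close> and whose sign can be read off.\<close>

lemma double_sum_div_diff:
  fixes n s t :: nat
  assumes "0 < s"
  defines "d \<equiv> int (n div s) - int t"
  shows "2 * (\<Sum>i<n. int (i div s)) - (2 * int n * int t - int s * int t * (int t + 1))
    = int s * d * (d - 1) + 2 * int (n mod s) * d"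
proof -
  have "int n = int s * int (n div s) + int (n mod s)"
    by (metis mult_div_mod_eq of_nat_add of_nat_mult)
  then show ?thesis
    unfolding double_sum_div[OF assms(1)] d_def by algebra
qed

lemma double_sum_div_ge:
  fixes t :: nat
  assumes "0 < s"
  shows "2 * int n * int t - int s * int t * (int t + 1) \<le> 2 * (\<Sum>i<n. int (i div s))"
proof -
  define d where "d = int (n div s) - int t"
  have r: "0 \<le> int (n mod s)" "int (n mod s) \<le> int s"
    using assms by (auto intro: less_imp_le)
  have "0 \<le> int s * d * (d - 1) + 2 * int (n mod s) * d"
  \<comment> \<open>For \<open>d \<ge> 0\<close> both summands are nonnegative,
    \<open>d * (d - 1)\<close> because \<open>d\<close> is an integer.\<close>
  proof (cases "0 \<le> d")
    case True
    then have "0 \<le> d * (d - 1)"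
      by (cases "d = 0") auto
    then have "0 \<le> int s * (d * (d - 1))"
      by (rule mult_nonneg_nonneg[rotated]) simp
    with True r(1) show ?thesis
      by (simp add: mult.assoc)
  next
    case False
    then have "int s * 2 \<le> int s * (1 - d)"
      by (intro mult_left_mono) auto
    \<comment> \<open>For \<open>d < 0\<close> the factor \<open>- d\<close> is pulled out; the rest
      is nonnegative since \<open>s * (1 - d) \<ge> 2 * s\<close> and the remainder is at most
      \<open>s\<close>.\<close>
    with r have "0 \<le> (- d) * (int s * (1 - d) - 2 * int (n mod s))"
      using False by (intro mult_nonneg_nonneg) auto
    then show ?thesis
      by (simp add: algebra_simps)
  qed
  then show ?thesis
    using double_sum_div_diff[OF assms, of n t] unfolding d_def by linarith
qed

lemma double_sum_div_eq:
  assumes "0 < s"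
  shows "2 * (\<Sum>i<n. int (i div s))
    = 2 * int n * int (n div s) - int s * int (n div s) * (int (n div s) + 1)"
  using double_sum_div_diff[OF assms, of n "n div s"] by simp

section \<open>Bounds for the values \<open>f_val\<close>\<close>

lemma f_val_le_iff:
  assumes "0 \<le> k" and "1 \<le> t"
  shows "f_val n m \<delta> k t \<le> of_int s
    \<longleftrightarrow> (k + 1) * (2 * int n * int t - s * int t * (int t + 1)) \<le> 2 * (2 * m - int n * \<delta>)"
proof -
  have pos: "0 < (of_int k + 1) * real t * (real t + 1)"
    using assms by auto
  have "f_val n m \<delta> k t \<le> of_int s \<longleftrightarrow>
      2 * (real n * (of_int \<delta> + real t * (of_int k + 1)) - 2 * of_int m)
        \<le> of_int s * ((of_int k + 1) * real t * (real t + 1))"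
    unfolding f_val_def using pos by (rule pos_divide_le_eq)
  also have "\<dots> \<longleftrightarrow> real_of_int ((k + 1) * (2 * int n * int t - s * int t * (int t + 1)))
      \<le> real_of_int (2 * (2 * m - int n * \<delta>))"
    by (simp add: algebra_simps)
  also have "\<dots> \<longleftrightarrow> (k + 1) * (2 * int n * int t - s * int t * (int t + 1))
      \<le> 2 * (2 * m - int n * \<delta>)"
    by (rule of_int_le_iff)
  finally show ?thesis .
qed

lemma f_val_le_all_iff:
  assumes "0 \<le> k" and "0 < s" and "int n * \<delta> \<le> 2 * m"
  shows "(\<forall>t\<ge>1. f_val n m \<delta> k t \<le> of_int (int s)) \<longleftrightarrow> Sigma_sum \<delta> k n s \<le> 2 * m"
proof
  assume bound: "\<forall>t\<ge>1. f_val n m \<delta> k t \<le> of_int (int s)"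
  show "Sigma_sum \<delta> k n s \<le> 2 * m"
  proof (cases "n div s = 0")
    case True
    then have "n < s"
      using assms(2) by (simp add: div_eq_0_iff)
    then show ?thesis
      using assms(3) by (simp add: Sigma_sum_lessThan)
  next
    case False
    then have "f_val n m \<delta> k (n div s) \<le> of_int (int s)"
      using bound by auto
    then have "(k + 1) * (2 * (\<Sum>i<n. int (i div s))) \<le> 2 * (2 * m - int n * \<delta>)"
      using False unfolding double_sum_div_eq[OF assms(2)]
      by (subst (asm) f_val_le_iff[OF assms(1)]) auto
    then show ?thesis
      unfolding Sigma_sum_lessThan by (simp add: algebra_simps)
  qed
next
  assume "Sigma_sum \<delta> k n s \<le> 2 * m"
  then have "2 * ((k + 1) * (\<Sum>i<n. int (i div s))) \<le> 2 * (2 * m - int n * \<delta>)"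
    unfolding Sigma_sum_lessThan by (simp add: algebra_simps)
  then have bound: "(k + 1) * (2 * (\<Sum>i<n. int (i div s))) \<le> 2 * (2 * m - int n * \<delta>)"
    by (simp add: mult.left_commute)
  show "\<forall>t\<ge>1. f_val n m \<delta> k t \<le> of_int (int s)"
  proof (intro allI impI)
    fix t :: nat
    assume "1 \<le> t"
    have "(k + 1) * (2 * int n * int t - int s * int t * (int t + 1))
        \<le> (k + 1) * (2 * (\<Sum>i<n. int (i div s)))"
      using assms(1) double_sum_div_ge[OF assms(2)] by (intro mult_left_mono) auto
    with bound show "f_val n m \<delta> k t \<le> of_int (int s)"
      unfolding f_val_le_iff[OF assms(1) \<open>1 \<le> t\<close>] by linarith
  qed
qed

text \<open>Serves the case \<open>s_star = 1\<close>, where \<open>f_val_le_all_iff\<close> cannot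
  be applied to the predecessor 0. With \<open>s = 0\<close> the quadratic term in
  \<open>f_val_le_iff\<close> disappears, and the remaining linear term outgrows the right-hand
  side.\<close>

lemma ex_f_val_pos:
  assumes "0 \<le> k" and "1 \<le> n" and "int n * \<delta> \<le> 2 * m"
  shows "\<exists>t\<ge>1. 0 < f_val n m \<delta> k t"
proof -
  \<comment> \<open>Any \<open>t\<close> above the surplus \<open>2 * m - n * \<delta>\<close>
    works, because \<open>(k + 1) * n \<ge> 1\<close>.\<close>
  define t where "t = nat (2 * m - int n * \<delta> + 1)"
  have t: "int t = 2 * m - int n * \<delta> + 1" "1 \<le> t"
    using assms(3) by (auto simp: t_def)
  have le: "1 * int t \<le> ((k + 1) * int n) * int t"
    using assms mult_mono[of 1 "k + 1" 1 "int n"] by (intro mult_right_mono) auto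
  have "2 * (2 * m - int n * \<delta>) < 2 * (1 * int t)"
    using t by simp
  also have "\<dots> \<le> 2 * (((k + 1) * int n) * int t)"
    using le by (rule mult_left_mono) simp
  finally have "\<not> f_val n m \<delta> k t \<le> of_int 0"
    unfolding f_val_le_iff[OF assms(1) t(2)] by (simp add: algebra_simps)
  with t(2) show ?thesis
    by auto
qed

text \<open>A bound uniform in \<open>t\<close>, so that only finitely many ceilings occur. The
  surplus contributes negatively, but it is divided by
  \<open>(k + 1) * t * (t + 1) / 2 \<ge> 1\<close>.\<close>

lemma f_val_lower_bound:
  assumes "0 \<le> k" and "1 \<le> t" and "int n * \<delta> \<le> 2 * m"
  shows "of_int (- (2 * m - int n * \<delta>) - 1) < f_val n m \<delta> k t"
proof -
  define M where "M = 2 * m - int n * \<delta>"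
  have "0 \<le> M"
    using assms(3) by (simp add: M_def)
  have "1 * 2 \<le> int t * (int t + 1)"
    using assms(2) by (intro mult_mono) auto
  then have "1 * 2 \<le> (k + 1) * (int t * (int t + 1))"
    using assms(1) by (intro mult_mono) auto
  then have "(M + 1) * 2 \<le> (M + 1) * ((k + 1) * (int t * (int t + 1)))"
    using \<open>0 \<le> M\<close> by (intro mult_left_mono) auto
  moreover have "0 \<le> (k + 1) * (2 * int n * int t)"
    using assms(1) by simp
  ultimately have "2 * M < (k + 1) * (2 * int n * int t) + (M + 1) * ((k + 1) * (int t * (int t + 1)))"
    by (simp add: algebra_simps)
  also have "\<dots> = (k + 1) * (2 * int n * int t - (- M - 1) * int t * (int t + 1))"
    by algebra
  finally show ?thesis
    unfolding M_def not_le[symmetric] f_val_le_iff[OF assms(1,2)] .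
qed

section \<open>Window numbers of sorted sequences\<close>

lemma sp_le_iff:
  assumes "sorted D" and "0 \<le> k"
  shows "sp D k \<le> s \<longleftrightarrow> (\<forall>i. i + s < length D \<longrightarrow> D ! i + (k + 1) \<le> D ! (i + s))"
proof
  assume le: "sp D k \<le> s"
  show "\<forall>i. i + s < length D \<longrightarrow> D ! i + (k + 1) \<le> D ! (i + s)"
  proof (intro allI impI, rule ccontr)
    fix i
    assume i: "i + s < length D" and "\<not> D ! i + (k + 1) \<le> D ! (i + s)"
    \<comment> \<open>Sortedness squeezes the terms from \<open>i\<close> to \<open>i + s\<close>
      into the window starting at \<open>D ! i\<close>, which then holds \<open>s + 1\<close>
      terms.\<close>
    then have "{i..i + s} \<subseteq> {j. j < length D \<and> D ! j \<in> {D ! i..D ! i + k}}"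
      using sorted_nth_mono[OF assms(1), of i] sorted_nth_mono[OF assms(1), of _ "i + s"]
      by fastforce
    then have "card {i..i + s} \<le> window_count D k (D ! i)"
      unfolding window_count_def length_filter_conv_card by (intro card_mono) auto
    also have "\<dots> \<le> sp D k"
      unfolding sp_def by (intro Max_ge finite_range_window_count) auto
    finally show False
      using le by simp
  qed
next
  assume gap: "\<forall>i. i + s < length D \<longrightarrow> D ! i + (k + 1) \<le> D ! (i + s)"
  have "window_count D k a \<le> s" for a
  proof -
    define I where "I = {i. i < length D \<and> D ! i \<in> {a..a + k}}"
    have "card I \<le> s"
    proof (cases "I = {}")
      case False
      have fin: "finite I"
        by (simp add: I_def)
      \<comment> \<open>From the first index in the window, going \<open>s\<close> or more places
        further raises the value by at least \<open>k + 1\<close> and so leaves the window.\<close>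
      define i where "i = Min I"
      have i: "i \<in> I"
        using fin False by (simp add: i_def)
      have "I \<subseteq> {i..<i + s}"
      proof
        fix j
        assume j: "j \<in> I"
        have "i \<le> j"
          using fin j by (simp add: i_def)
        moreover have "j < i + s"
        proof (rule ccontr)
          assume "\<not> j < i + s"
          moreover have "j < length D"
            using j by (simp add: I_def)
          ultimately have "D ! i + (k + 1) \<le> D ! (i + s)" "D ! (i + s) \<le> D ! j"
            using gap sorted_nth_mono[OF assms(1)] by auto
          then show False
            using i j by (auto simp: I_def)
        qed
        ultimately show "j \<in> {i..<i + s}"
          by simp
      qed
      from card_mono[OF _ this] show ?thesis
        by simp
    qed simp
    then show ?thesis
      unfolding window_count_def length_filter_conv_card I_def .
  qed
  then show "sp D k \<le> s"
    unfolding sp_def using finite_range_window_count by (subst Max_le_iff) auto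
qed

lemma sp_pos:
  assumes "D \<noteq> []" and "sorted D" and "0 \<le> k"
  shows "0 < sp D k"
proof (rule ccontr)
  assume "\<not> 0 < sp D k"
  \<comment> \<open>For \<open>s = 0\<close> the gap criterion compares the first term with
    itself.\<close>
  then have "D ! 0 + (k + 1) \<le> D ! (0 + 0)"
    using assms sp_le_iff[OF assms(2,3), of 0] by auto
  then show False
    using assms(3) by simp
qed

lemma Sigma_sum_sp_le:
  assumes "D \<in> delta_sequences_with_sum n m \<delta>" and "0 \<le> k"
  shows "Sigma_sum \<delta> k n (sp D k) \<le> 2 * m"
proof -
  have D: "length D = n" "D \<noteq> []" "sorted D" "D ! 0 = \<delta>" "sum_list D = 2 * m"
    using assms(1) by (auto simp: delta_sequences_with_sum_def delta_sequence_def hd_conv_nth)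
  define s where "s = sp D k"
  have s: "0 < s"
    using sp_pos[OF D(2,3) assms(2)] by (simp add: s_def)
  have gap: "D ! i + (k + 1) \<le> D ! (i + s)" if "i + s < n" for i
    using that sp_le_iff[OF D(3) assms(2), of s] D(1) by (simp add: s_def)
  \<comment> \<open>The induction steps back \<open>s\<close> indices at a time, gaining one gap of
    \<open>k + 1\<close> per step, until it reaches the first block, where every term is at least
    \<open>\<delta>\<close>.\<close>
  have lower: "\<delta> + (k + 1) * int (i div s) \<le> D ! i" if "i < n" for i
    using that
  proof (induction i rule: less_induct)
    case (less i)
    show ?case
    proof (cases "i < s")
      case True
      then show ?thesis
        using sorted_nth_mono[OF D(3), of 0 i] less.prems D(1,4) by simp
    next
      case False
      then have "int (i div s) = int ((i - s) div s) + 1"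
        using s by (simp add: le_div_geq)
      then have "\<delta> + (k + 1) * int (i div s) = \<delta> + (k + 1) * int ((i - s) div s) + (k + 1)"
        by (simp add: algebra_simps)
      also have "\<dots> \<le> D ! (i - s) + (k + 1)"
        using less False s by simp
      also have "\<dots> \<le> D ! i"
        using gap[of "i - s"] False less.prems by simp
      finally show ?thesis .
    qed
  qed
  have "Sigma_sum \<delta> k n s = (\<Sum>i<n. \<delta> + (k + 1) * int (i div s))"
    by (simp add: Sigma_sum_lessThan sum.distrib sum_distrib_left)
  also have "\<dots> \<le> (\<Sum>i<n. D ! i)"
    using lower by (intro sum_mono) auto
  also have "\<dots> = 2 * m"
    using D(1,5) by (simp add: sum_list_sum_nth atLeast0LessThan)
  finally show ?thesis
    unfolding s_def .
qed

lemma ex_delta_sequence_sp_le: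
  assumes "2 \<le> n" and "0 \<le> k" and "0 < s" and "Sigma_sum \<delta> k n s \<le> 2 * m"
  shows "\<exists>D \<in> delta_sequences_with_sum n m \<delta>. sp D k \<le> s"
proof -
  define R where "R = 2 * m - Sigma_sum \<delta> k n s"
  \<comment> \<open>The pointwise least sequence with gaps \<open>k + 1\<close> at distance
    \<open>s\<close>, with the surplus \<open>R\<close> added at the end. As
    \<open>n \<ge> 2\<close>, the last index is not 0 and the first term stays
    \<open>\<delta>\<close>.\<close>
  define g where "g i = \<delta> + (k + 1) * int (i div s) + (if i = n - 1 then R else 0)" for i
  define D where "D = map g [0..<n]"
  have R: "0 \<le> R"
    using assms(4) by (simp add: R_def)
  have len: "length D = n" and nth: "\<And>i. i < n \<Longrightarrow> D ! i = g i"
    by (simp_all add: D_def)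
  have mono: "g i \<le> g j" if "i \<le> j" "j < n" for i j
  proof -
    have "(k + 1) * int (i div s) \<le> (k + 1) * int (j div s)"
      using assms(2) that by (intro mult_left_mono) (auto intro: div_le_mono)
    then show ?thesis
      using that R by (auto simp: g_def)
  qed
  have sorted: "sorted D"
    using mono by (auto simp: sorted_iff_nth_mono len nth)
  have "(\<Sum>i<n. g i) = Sigma_sum \<delta> k n s + (\<Sum>i<n. if i = n - 1 then R else 0)"
    by (simp add: g_def sum.distrib Sigma_sum_lessThan sum_distrib_left)
  also have "(\<Sum>i<n. if i = n - 1 then R else 0) = R"
    using assms(1) by (simp add: sum.delta)
  finally have "sum_list D = 2 * m"
    by (simp add: D_def R_def interv_sum_list_conv_sum_set_nat atLeast0LessThan)
  moreover have "D ! 0 = \<delta>"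
    using assms(1) by (simp add: nth g_def)
  ultimately have "D \<in> delta_sequences_with_sum n m \<delta>"
    using sorted len assms(1)
    by (cases D) (auto simp: delta_sequences_with_sum_def delta_sequence_def)
  moreover have "sp D k \<le> s"
    unfolding sp_le_iff[OF sorted assms(2)] len
  proof (intro allI impI)
    fix i
    assume "i + s < n"
    \<comment> \<open>Since \<open>s > 0\<close>, index \<open>i\<close> is not the last one, so
      \<open>R\<close> can only enlarge the right-hand side; the quotient grows by exactly
      1.\<close>
    then show "D ! i + (k + 1) \<le> D ! (i + s)"
      using assms(3) R by (auto simp: nth g_def algebra_simps)
  qed
  ultimately show ?thesis
    by blast
qed

section \<open>The two equalities for \<open>s_star\<close>\<close>

lemma s_star_le:
  assumes "0 < s" and "Sigma_sum \<delta> k n s \<le> 2 * m"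
  shows "s_star n m \<delta> k \<le> s"
  unfolding s_star_def using assms by (intro Least_le) simp

lemma
  assumes "0 \<le> k" and "1 \<le> n" and "int n * \<delta> \<le> 2 * m"
  shows finite_ceiling_f_val: "finite ((\<lambda>t. \<lceil>f_val n m \<delta> k t\<rceil>) ` {1..})"
    and Max_ceiling_f_val: "Max ((\<lambda>t. \<lceil>f_val n m \<delta> k t\<rceil>) ` {1..}) = int (s_star n m \<delta> k)"
proof -
  let ?A = "(\<lambda>t. \<lceil>f_val n m \<delta> k t\<rceil>) ` {1..}"
  define s where "s = s_star n m \<delta> k"
  have s: "1 \<le> s" "Sigma_sum \<delta> k n s \<le> 2 * m"
    using s_star_well_defined[OF assms(2,3)] by (auto simp: s_def)
  have upper: "\<lceil>f_val n m \<delta> k t\<rceil> \<le> int s" if "1 \<le> t" for t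
    using f_val_le_all_iff[OF assms(1) _ assms(3), of s] s that by (simp add: ceiling_le_iff)
  have "?A \<subseteq> {- (2 * m - int n * \<delta>) - 1..int s}"
  proof (rule image_subsetI)
    fix t :: nat
    assume "t \<in> {1..}"
    then have "1 \<le> t"
      by simp
    then show "\<lceil>f_val n m \<delta> k t\<rceil> \<in> {- (2 * m - int n * \<delta>) - 1..int s}"
      using upper less_imp_le[OF iffD2[OF less_ceiling_iff f_val_lower_bound[OF assms(1) _ assms(3)]]]
      by simp
  qed
  then show fin: "finite ?A"
    by (rule finite_subset) simp
  \<comment> \<open>Attainment: by minimality of \<open>s\<close>, the number \<open>s - 1\<close>
    does not bound every \<open>f_val\<close>, and a value above \<open>s - 1\<close> has ceiling at
    least \<open>s\<close>.\<close>
  have "\<exists>t\<ge>1. of_int (int s - 1) < f_val n m \<delta> k t"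
  proof (cases "s = 1")
    case True
    then show ?thesis
      using ex_f_val_pos[OF assms] by simp
  next
    case False
    then have "\<not> Sigma_sum \<delta> k n (s - 1) \<le> 2 * m"
      using s_star_le[of "s - 1" \<delta> k n m] s(1) unfolding s_def[symmetric] by auto
    then show ?thesis
      using f_val_le_all_iff[OF assms(1) _ assms(3), of "s - 1"] False s(1)
      by (auto simp: not_le of_nat_diff)
  qed
  then obtain t where t: "1 \<le> t" "int s - 1 < \<lceil>f_val n m \<delta> k t\<rceil>"
    by (auto simp only: less_ceiling_iff)
  then have "\<lceil>f_val n m \<delta> k t\<rceil> = int s"
    using upper[of t] by linarith
  with t(1) have "int s \<in> ?A"
    by (metis atLeast_iff imageI)
  then show "Max ?A = int (s_star n m \<delta> k)"
    using fin upper unfolding s_def by (intro Max_eqI) auto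
qed

theorem theorem8:
  fixes n :: nat and m \<delta> k :: int
  assumes "2 \<le> n" and "0 \<le> \<delta>" and "0 \<le> k" and "int n * \<delta> \<le> 2 * m"
  shows "finite ((\<lambda>t. \<lceil>f_val n m \<delta> k t\<rceil>) ` {1..})
    \<and> Max ((\<lambda>t. \<lceil>f_val n m \<delta> k t\<rceil>) ` {1..}) = int (s_star n m \<delta> k)
    \<and> finite ((\<lambda>D. sp D k) ` delta_sequences_with_sum n m \<delta>)
    \<and> delta_sequences_with_sum n m \<delta> \<noteq> {}
    \<and> s_star n m \<delta> k = Min ((\<lambda>D. sp D k) ` delta_sequences_with_sum n m \<delta>)"
proof -
  let ?S = "delta_sequences_with_sum n m \<delta>"
  have n: "1 \<le> n"
    using assms(1) by simp
  have seq: "length D = n" "D \<noteq> []" "sorted D" if "D \<in> ?S" for D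
    using that by (auto simp: delta_sequences_with_sum_def delta_sequence_def)
  \<comment> \<open>At \<open>s = n\<close> the gap criterion is vacuous, so \<open>n\<close> bounds
    every window number.\<close>
  have "(\<lambda>D. sp D k) ` ?S \<subseteq> {..n}"
    using seq sp_le_iff[OF _ assms(3)] by auto
  then have fin: "finite ((\<lambda>D. sp D k) ` ?S)"
    by (rule finite_subset) simp
  have lower: "s_star n m \<delta> k \<le> sp D k" if "D \<in> ?S" for D
    using s_star_le[OF sp_pos Sigma_sum_sp_le] seq[OF that] that assms(3) by auto
  obtain D where D: "D \<in> ?S" "sp D k \<le> s_star n m \<delta> k"
    using ex_delta_sequence_sp_le[OF assms(1,3)] s_star_well_defined[OF n assms(4)]
    by (metis less_le_trans zero_less_one)
  with lower[of D] have "s_star n m \<delta> k \<in> (\<lambda>D. sp D k) ` ?S"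
    by (metis imageI le_antisym)
  then have "Min ((\<lambda>D. sp D k) ` ?S) = s_star n m \<delta> k"
    using fin lower by (intro Min_eqI) auto
  with fin D(1) finite_ceiling_f_val[OF assms(3) n assms(4)]
    Max_ceiling_f_val[OF assms(3) n assms(4)] show ?thesis
    by auto
qed

end
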